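(* Let $\Phi:\mathcal{M}_q^2\to\mathcal{M}_p$ be a positive multilinear mapping. Then for all strictly positive matrices $A,B\in\mathcal{M}_q$ and all $X,Y\in\mathcal{M}_q$, the function $$f(t)=\Phi\left(X^*A^{1+t}X,\,Y^*B^{1-t}Y\right)+\Phi\left(X^*A^{1-t}X,\,Y^*B^{1+t}Y\right)$$ is convex on $\mathbb{R}$ and attains its minimum at $t=0$ (with respect to the order $\leq$ on Hermitian matrices).
   Context: $\mathcal{M}_p$ is the algebra of $p\times p$ complex matrices. A matrix $A$ is positive ($A\geq0$) if it is Hermitian with all eigenvalues nonnegative, and strictly positive if moreover invertible; $A\leq B$ means $B-A\geq0$. A map $\Phi:\mathcal{M}_q^2\to\mathcal{M}_p$ is multilinear if it is linear in each of its variables, and positive if $\Phi(A,B)\geq0$ whenever $A,B\geq0$. The function $f$ is Hermitian-matrix valued; convexity and the minimum are understood in the order $\leq$, i.e. $f(\theta s+(1-\theta)t)\leq\theta f(s)+(1-\theta)f(t)$ for $s,t\in\mathbb{R}$, $\theta\in[0,1]$, and $f(0)\leq f(t)$ for all $t\in\mathbb{R}$. *)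

theory Defs
  imports Complex_Main "Jordan_Normal_Form.Schur_Decomposition"
begin

definition hermitian_mat :: "complex mat \<Rightarrow> bool" where
  "hermitian_mat A \<longleftrightarrow> square_mat A \<and> mat_adjoint A = A"

(* The order on complex is the one of HOL-Library.Complex_Order: 0 <= k says that k is
   a nonnegative real. *)
definition positive_mat :: "complex mat \<Rightarrow> bool" where
  "positive_mat A \<longleftrightarrow> hermitian_mat A \<and> (\<forall>k. eigenvalue A k \<longrightarrow> 0 \<le> k)"

definition strictly_positive_mat :: "complex mat \<Rightarrow> bool" where
  "strictly_positive_mat A \<longleftrightarrow> positive_mat A \<and> invertible_mat A"

definition loewner_le :: "complex mat \<Rightarrow> complex mat \<Rightarrow> bool" where
  "loewner_le A B \<longleftrightarrow> positive_mat (B - A)"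

definition unitary_mat :: "complex mat \<Rightarrow> bool" where
  "unitary_mat U \<longleftrightarrow> square_mat U \<and> inverts_mat U (mat_adjoint U) \<and> inverts_mat (mat_adjoint U) U"

definition real_diag :: "nat \<Rightarrow> (nat \<Rightarrow> real) \<Rightarrow> complex mat" where
  "real_diag n d = mat_diag n (\<lambda>i. complex_of_real (d i))"

definition spectral_decomposition :: "complex mat \<Rightarrow> complex mat \<Rightarrow> (nat \<Rightarrow> real) \<Rightarrow> bool" where
  "spectral_decomposition A U d \<longleftrightarrow>
     U \<in> carrier_mat (dim_row A) (dim_row A) \<and> unitary_mat U \<and>
     A = U * real_diag (dim_row A) d * mat_adjoint U"

(* The real power A^s by functional calculus, meant for strictly positive A; by
   mat_rpow_eq below the value does not depend on the chosen spectral decomposition. *)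
definition mat_rpow :: "complex mat \<Rightarrow> real \<Rightarrow> complex mat" where
  "mat_rpow A s = (THE B. \<exists>U d. spectral_decomposition A U d \<and>
     B = U * real_diag (dim_row A) (\<lambda>i. d i powr s) * mat_adjoint U)"

definition multilinear_map2 ::
  "nat \<Rightarrow> nat \<Rightarrow> (complex mat \<Rightarrow> complex mat \<Rightarrow> complex mat) \<Rightarrow> bool" where
  "multilinear_map2 q p \<Phi> \<longleftrightarrow>
     (\<forall>A\<in>carrier_mat q q. \<forall>B\<in>carrier_mat q q. \<Phi> A B \<in> carrier_mat p p) \<and>
     (\<forall>A\<in>carrier_mat q q. \<forall>A'\<in>carrier_mat q q. \<forall>B\<in>carrier_mat q q.
        \<Phi> (A + A') B = \<Phi> A B + \<Phi> A' B) \<and>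
     (\<forall>A\<in>carrier_mat q q. \<forall>B\<in>carrier_mat q q. \<forall>c. \<Phi> (c \<cdot>\<^sub>m A) B = c \<cdot>\<^sub>m \<Phi> A B) \<and>
     (\<forall>A\<in>carrier_mat q q. \<forall>B\<in>carrier_mat q q. \<forall>B'\<in>carrier_mat q q.
        \<Phi> A (B + B') = \<Phi> A B + \<Phi> A B') \<and>
     (\<forall>A\<in>carrier_mat q q. \<forall>B\<in>carrier_mat q q. \<forall>c. \<Phi> A (c \<cdot>\<^sub>m B) = c \<cdot>\<^sub>m \<Phi> A B)"

definition positive_map2 ::
  "nat \<Rightarrow> (complex mat \<Rightarrow> complex mat \<Rightarrow> complex mat) \<Rightarrow> bool" where
  "positive_map2 q \<Phi> \<longleftrightarrow>
     (\<forall>A\<in>carrier_mat q q. \<forall>B\<in>carrier_mat q q.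
        positive_mat A \<longrightarrow> positive_mat B \<longrightarrow> positive_mat (\<Phi> A B))"

definition loewner_convex :: "(real \<Rightarrow> complex mat) \<Rightarrow> bool" where
  "loewner_convex f \<longleftrightarrow>
     (\<forall>s t \<theta>. 0 \<le> \<theta> \<longrightarrow> \<theta> \<le> 1 \<longrightarrow>
        loewner_le (f (\<theta> * s + (1 - \<theta>) * t))
          (complex_of_real \<theta> \<cdot>\<^sub>m f s + complex_of_real (1 - \<theta>) \<cdot>\<^sub>m f t))"

lemma mat_adjoint_dim [simp]:
  "A \<in> carrier_mat n m \<Longrightarrow> mat_adjoint A \<in> carrier_mat m n"
  by (auto simp: mat_adjoint_def)

lemma real_diag_dim [simp]: "real_diag n d \<in> carrier_mat n n"
  by (simp add: real_diag_def)

lemma spectral_decomposition_rpow_unique: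
  assumes U: "spectral_decomposition A U d" and V: "spectral_decomposition A V e"
  shows "U * real_diag (dim_row A) (\<lambda>i. d i powr s) * mat_adjoint U =
         V * real_diag (dim_row A) (\<lambda>i. e i powr s) * mat_adjoint V"
proof -
  define n where "n = dim_row A"
  define D where "D = real_diag n d"
  define E where "E = real_diag n e"
  define D' where "D' = real_diag n (\<lambda>i. d i powr s)"
  define E' where "E' = real_diag n (\<lambda>i. e i powr s)"
  define U' where "U' = mat_adjoint U"
  define V' where "V' = mat_adjoint V"
  have c [simp]: "U \<in> carrier_mat n n" "V \<in> carrier_mat n n"
    using U V by (auto simp: spectral_decomposition_def n_def)
  have c' [simp]: "U' \<in> carrier_mat n n" "V' \<in> carrier_mat n n"
    "D \<in> carrier_mat n n" "E \<in> carrier_mat n n" "D' \<in> carrier_mat n n" "E' \<in> carrier_mat n n"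
    by (auto simp: U'_def V'_def D_def E_def D'_def E'_def)
  have dims [simp]: "dim_row U = n" "dim_row V = n" "dim_row U' = n" "dim_row V' = n"
    using c(1,2)[THEN carrier_matD(1)] c'(1,2)[THEN carrier_matD(1)] by blast+
  have inv: "U * U' = 1\<^sub>m n" "U' * U = 1\<^sub>m n" "V * V' = 1\<^sub>m n" "V' * V = 1\<^sub>m n"
    using U V by (auto simp: spectral_decomposition_def unitary_mat_def inverts_mat_def
        simp flip: U'_def V'_def)
  have eq: "U * D * U' = V * E * V'"
    using U V unfolding spectral_decomposition_def D_def E_def U'_def V'_def n_def by metis
  define W where "W = V' * U"
  have W [simp]: "W \<in> carrier_mat n n" by (simp add: W_def mult_carrier_mat[of _ n n])
  note a = assoc_mult_mat[of _ n n _ n _ n] mult_carrier_mat[of _ n n _ n]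
    left_mult_one_mat[of _ n n] right_mult_one_mat[of _ n n]
  have "W * D = V' * (U * D * U') * U"
    by (simp add: W_def a inv)
  also have "\<dots> = (V' * V) * E * (V' * U)"
    unfolding eq by (simp add: a)
  finally have WD: "W * D = E * W"
    using W by (simp add: inv W_def a)
  have ent: "W $$ (i,j) * complex_of_real (d j) = complex_of_real (e i) * W $$ (i,j)"
    if "i < n" "j < n" for i j
    using arg_cong[OF WD, of "\<lambda>M. M $$ (i,j)"] that
    by (simp add: D_def E_def real_diag_def mat_diag_mult_left[of _ n n] mat_diag_mult_right[of _ n n])
  have "W * D' = E' * W"
    unfolding D'_def E'_def real_diag_def
      mat_diag_mult_left[OF W] mat_diag_mult_right[OF W]
  proof (rule cong_mat)
    fix i j assume ij: "i < n" "j < n"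
    show "(case (i,j) of (i,j) \<Rightarrow> W $$ (i,j) * complex_of_real (d j powr s)) =
          (case (i,j) of (i,j) \<Rightarrow> complex_of_real (e i powr s) * W $$ (i,j))"
    proof (cases "W $$ (i,j) = 0")
      case False
      hence "d j = e i" using ent[OF ij] by (simp add: mult.commute)
      thus ?thesis by simp
    qed simp
  qed auto
  hence "V * (W * D') * U' = V * (E' * W) * U'" by simp
  moreover have "V * (W * D') * U' = (V * V') * (U * D' * U')" by (simp add: W_def a)
  moreover have "V * (E' * W) * U' = V * E' * V' * (U * U')" by (simp add: W_def a)
  moreover have "U * D' * U' \<in> carrier_mat n n" "V * E' * V' \<in> carrier_mat n n"
    by (simp_all add: a)
  ultimately have "U * D' * U' = V * E' * V'"
    by (simp add: inv left_mult_one_mat[of _ n n] right_mult_one_mat[of _ n n])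
  thus ?thesis by (simp add: D'_def E'_def U'_def V'_def n_def)
qed

lemma mat_rpow_eq:
  assumes "spectral_decomposition A U d"
  shows "mat_rpow A s = U * real_diag (dim_row A) (\<lambda>i. d i powr s) * mat_adjoint U"
  unfolding mat_rpow_def
proof (rule the_equality)
  fix B
  assume "\<exists>V e. spectral_decomposition A V e \<and>
    B = V * real_diag (dim_row A) (\<lambda>i. e i powr s) * mat_adjoint V"
  then obtain V e where V: "spectral_decomposition A V e"
    and B: "B = V * real_diag (dim_row A) (\<lambda>i. e i powr s) * mat_adjoint V" by blast
  show "B = U * real_diag (dim_row A) (\<lambda>i. d i powr s) * mat_adjoint U"
    unfolding B by (rule spectral_decomposition_rpow_unique[OF V assms])
qed (use assms in blast)

end

theory Submission
  imports Defs "Jordan_Normal_Form.Spectral_Radius"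
begin

text \<open>
  Both powers are diagonalised, after which only scalars depend on \<open>t\<close>. If \<open>A\<close> has
  eigenvalues \<open>d i\<close> and an orthonormal eigenbasis \<open>u i\<close>, then for every exponent \<open>s\<close> the matrix
  \<open>X\<^sup>* A\<^sup>s X\<close> is the sum of \<open>(d i)\<^sup>s P i\<close>, where \<open>P i\<close> is the rank-one positive
  matrix \<open>(X\<^sup>* u i) (X\<^sup>* u i)\<^sup>*\<close>, the same for all \<open>s\<close>; likewise \<open>Y\<^sup>* B\<^sup>s Y\<close> is
  the sum of \<open>(e j)\<^sup>s Q j\<close> (\<open>congruence_mat_rpow\<close>). Multilinearity of \<open>\<Phi>\<close>
  (\<open>multilinear_map2_mat_lincomb\<close>) turns \<open>f t\<close> into the sum over all \<open>(i,j)\<close> of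
  \<open>g\<^bsub>ij\<^esub>(t) \<Phi> (P i) (Q j)\<close> with the scalar functions
  \<open>g\<^bsub>ij\<^esub>(t) = d\<^sup>1\<^sup>+\<^sup>t e\<^sup>1\<^sup>-\<^sup>t + d\<^sup>1\<^sup>-\<^sup>t e\<^sup>1\<^sup>+\<^sup>t\<close>, where \<open>d = d i\<close> and \<open>e = e j\<close>.

  Each \<open>g\<^bsub>ij\<^esub>\<close> is a sum of exponentials of affine functions of \<open>t\<close>, hence convex, and each
  coefficient matrix \<open>\<Phi> (P i) (Q j)\<close> is positive because \<open>\<Phi>\<close> is. The convexity defect of
  \<open>f\<close> is therefore a combination of positive matrices with nonnegative coefficients, hence
  positive (\<open>positive_mat_lincomb\<close>). As \<open>f\<close> is even, convexity between \<open>t\<close> and \<open>- t\<close>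
  gives \<open>f 0 \<le> f t\<close>.

  Positivity is given through eigenvalues, a form that does not pass to sums. The bridge is the
  quadratic form \<open>v\<^sup>* A v\<close>, whose nonnegativity for all \<open>v\<close> is equivalent to positivity of a
  Hermitian \<open>A\<close>; this equivalence, as well as the existence of the diagonalisations, rests on the
  finite-dimensional spectral theorem (\<open>hermitian_eigenbasis\<close>).
\<close>

section \<open>Adjoints and Hermitian matrices\<close>

lemma dim_mat_adjoint [simp]:
  "dim_row (mat_adjoint A) = dim_col A" "dim_col (mat_adjoint A) = dim_row A"
  by (simp_all add: mat_adjoint_def)

lemma mat_adjoint_index:
  assumes "A \<in> carrier_mat n m" "i < m" "j < n"
  shows "mat_adjoint A $$ (i,j) = cnj (A $$ (j,i))"
  using assms by (simp add: mat_adjoint_def mat_of_rows_index)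

lemma mat_adjoint_mult:
  fixes A B :: "complex mat"
  assumes A: "A \<in> carrier_mat n m" and B: "B \<in> carrier_mat m k"
  shows "mat_adjoint (A * B) = mat_adjoint B * mat_adjoint A"
proof (rule eq_matI)
  note c = mat_adjoint_dim[OF A] mat_adjoint_dim[OF B] mat_adjoint_dim[OF mult_carrier_mat[OF A B]]
  fix i j assume "i < dim_row (mat_adjoint B * mat_adjoint A)"
    and "j < dim_col (mat_adjoint B * mat_adjoint A)"
  hence ij: "i < k" "j < n" using c by auto
  show "mat_adjoint (A * B) $$ (i, j) = (mat_adjoint B * mat_adjoint A) $$ (i, j)"
    using ij A B c
    by (simp add: mat_adjoint_index[OF mult_carrier_mat[OF A B]] scalar_prod_def
        mat_adjoint_index[OF A] mat_adjoint_index[OF B] mult.commute)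
qed (use A B in auto)

lemma mat_adjoint_adjoint:
  assumes A: "A \<in> carrier_mat n m"
  shows "mat_adjoint (mat_adjoint A) = (A :: complex mat)"
proof (rule eq_matI)
  fix i j assume "i < dim_row A" "j < dim_col A"
  thus "mat_adjoint (mat_adjoint A) $$ (i, j) = A $$ (i, j)"
    using A by (simp add: mat_adjoint_index[OF mat_adjoint_dim[OF A]] mat_adjoint_index[OF A])
qed (use A in auto)

lemma inner_mat_adjoint:
  fixes A :: "complex mat"
  assumes A: "A \<in> carrier_mat n m" and x: "x \<in> carrier_vec m" and y: "y \<in> carrier_vec n"
  shows "(A *\<^sub>v x) \<bullet>c y = x \<bullet>c (mat_adjoint A *\<^sub>v y)"
proof -
  have "(A *\<^sub>v x) \<bullet>c y = (\<Sum>i<n. \<Sum>j<m. A $$ (i,j) * x $ j * cnj (y $ i))"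
    using A x y by (simp add: scalar_prod_def sum_distrib_right atLeast0LessThan)
  also have "\<dots> = (\<Sum>j<m. \<Sum>i<n. A $$ (i,j) * x $ j * cnj (y $ i))"
    by (rule sum.swap)
  also have "\<dots> = x \<bullet>c (mat_adjoint A *\<^sub>v y)"
    using A x y mat_adjoint_dim[OF A]
    by (simp add: scalar_prod_def sum_distrib_left atLeast0LessThan mat_adjoint_index[OF A] mult_ac)
  finally show ?thesis .
qed

lemma hermitian_mat_iff:
  assumes A: "A \<in> carrier_mat n n"
  shows "hermitian_mat A \<longleftrightarrow> (\<forall>i<n. \<forall>j<n. cnj (A $$ (j,i)) = A $$ (i,j))"
proof
  assume "hermitian_mat A"
  thus "\<forall>i<n. \<forall>j<n. cnj (A $$ (j,i)) = A $$ (i,j)"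
    using mat_adjoint_index[OF A] by (metis hermitian_mat_def)
next
  assume *: "\<forall>i<n. \<forall>j<n. cnj (A $$ (j,i)) = A $$ (i,j)"
  have "mat_adjoint A = A"
    by (rule eq_matI) (use A * mat_adjoint_index[OF A] in auto)
  thus "hermitian_mat A" using A by (auto simp: hermitian_mat_def)
qed

lemma mat_adjoint_self_mult_index:
  fixes W :: "complex mat"
  assumes W: "W \<in> carrier_mat n m" and "i < m" "j < m"
  shows "(mat_adjoint W * W) $$ (i,j) = col W j \<bullet>c col W i"
  using assms mat_adjoint_dim[OF W]
  by (simp add: scalar_prod_def mat_adjoint_index[OF W] mult.commute)

section \<open>The spectral theorem\<close>

text \<open>
  Extend \<open>v\<close> to a basis and apply Gram-Schmidt, which keeps the first vector; its output is
  orthogonal but not normalised, so the columns are rescaled afterwards.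
\<close>
lemma unitary_completion:
  fixes v :: "complex vec"
  assumes v: "v \<in> carrier_vec n" and v0: "v \<noteq> 0\<^sub>v n"
  shows "\<exists>W c. W \<in> carrier_mat n n \<and> mat_adjoint W * W = 1\<^sub>m n \<and> col W 0 = c \<cdot>\<^sub>v v"
proof -
  interpret cof_vec_space n "TYPE(complex)" .
  note b = basis_completion[OF v v0]
  define ws where "ws = gram_schmidt n (basis_completion v)"
  have indep: "\<not> lin_dep (set (basis_completion v))" using b by blast
  have ws: "set ws \<subseteq> carrier_vec n" "corthogonal ws" "length ws = n"
    using gram_schmidt_result[OF b(2,4) indep ws_def] b by auto
  have "basis_completion v = v # tl (basis_completion v)"
    by (simp add: basis_completion_def Let_def)
  hence hd: "hd ws = v" using gram_schmidt_hd[OF v] unfolding ws_def by metis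
  have n: "0 < n" using v v0 by (cases n) auto
  have ws0: "ws ! 0 = v" using hd n ws(3) by (metis hd_conv_nth length_greater_0_conv)
  define r where "r i = complex_of_real (1 / sqrt (Re (ws ! i \<bullet>c ws ! i)))" for i
  define W where "W = mat_of_cols n (map (\<lambda>i. r i \<cdot>\<^sub>v ws ! i) [0..<n])"
  have W: "W \<in> carrier_mat n n" by (simp add: W_def mat_of_cols_def)
  have wsc: "ws ! i \<in> carrier_vec n" if "i < n" for i using ws that by auto
  have colW: "col W i = r i \<cdot>\<^sub>v ws ! i" if "i < n" for i
    using that wsc[OF that] by (simp add: W_def)
  have "(mat_adjoint W * W) $$ (i,j) = (if i = j then 1 else 0)" if ij: "i < n" "j < n" for i j
  proof -
    have c: "ws ! i \<in> carrier_vec n" "ws ! j \<in> carrier_vec n" using wsc ij by auto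
    have eq: "(mat_adjoint W * W) $$ (i,j) = r j * cnj (r i) * (ws ! j \<bullet>c ws ! i)"
      using c by (simp add: mat_adjoint_self_mult_index[OF W ij] colW ij conjugate_smult_vec)
    show ?thesis
    proof (cases "i = j")
      case True
      have "ws ! i \<bullet>c ws ! i \<noteq> 0"
        using corthogonalD[OF ws(2), of i i] ij ws(3) by auto
      moreover have "0 \<le> ws ! i \<bullet>c ws ! i" by (rule conjugate_square_ge_0_vec)
      ultimately have x: "Im (ws ! i \<bullet>c ws ! i) = 0" "0 < Re (ws ! i \<bullet>c ws ! i)"
        by (auto simp: less_eq_complex_def complex_eq_iff simp del: conjugate_square_eq_0_vec)
      have "1 / sqrt y * (1 / sqrt y) * y = 1" if "0 < y" for y :: real
        using that by simp
      from this[OF x(2)] show ?thesis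
        using True x(1) unfolding eq r_def by (auto simp: complex_eq_iff)
    next
      case False
      hence "ws ! j \<bullet>c ws ! i = 0"
        using corthogonalD[OF ws(2), of j i] ij ws(3) by auto
      thus ?thesis using False eq by simp
    qed
  qed
  hence "mat_adjoint W * W = 1\<^sub>m n"
    using W mat_adjoint_dim[OF W] by (intro eq_matI) auto
  thus ?thesis using W colW[OF n] ws0 by metis
qed

text \<open>
  The spectral theorem, by deflation: conjugating \<open>A\<close> with a unitary \<open>W\<close> whose first column is an
  eigenvector yields a Hermitian \<open>B\<close> with first column \<open>k e\<^sub>0\<close>. By symmetry its first row has
  the same shape and \<open>k\<close> is real, so \<open>B\<close> is block diagonal, and an eigenbasis of the lower block
  \<open>C\<close> lifts first to \<open>B\<close> by prepending a zero and then to \<open>A\<close> by the isometry \<open>W\<close>.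
\<close>
lemma hermitian_eigenbasis:
  assumes "A \<in> carrier_mat n n" and "hermitian_mat A"
  shows "\<exists>u (d :: nat \<Rightarrow> real). \<forall>i<n. u i \<in> carrier_vec n \<and>
    A *\<^sub>v u i = complex_of_real (d i) \<cdot>\<^sub>v u i \<and>
    (\<forall>j<n. u i \<bullet>c u j = (if i = j then 1 else 0))"
  using assms
proof (induction n arbitrary: A)
  case 0
  thus ?case by auto
next
  case (Suc n)
  note A = Suc.prems(1)
  have adjA: "mat_adjoint A = A" using Suc.prems(2) by (simp add: hermitian_mat_def)
  obtain k where "eigenvalue A k"
    using spectrum_non_empty[OF A] unfolding spectrum_def by auto
  then obtain v where v: "v \<in> carrier_vec (Suc n)" "v \<noteq> 0\<^sub>v (Suc n)" "A *\<^sub>v v = k \<cdot>\<^sub>v v"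
    using A unfolding eigenvalue_def eigenvector_def by auto
  obtain W c where W: "W \<in> carrier_mat (Suc n) (Suc n)"
    and W1: "mat_adjoint W * W = 1\<^sub>m (Suc n)" and W0: "col W 0 = c \<cdot>\<^sub>v v"
    using unitary_completion[OF v(1,2)] by blast
  define W' where "W' = mat_adjoint W"
  have W': "W' \<in> carrier_mat (Suc n) (Suc n)" using W by (simp add: W'_def)
  have W'W: "W' * W = 1\<^sub>m (Suc n)" using W1 by (simp add: W'_def)
  have WW': "W * W' = 1\<^sub>m (Suc n)" by (rule mat_mult_left_right_inverse[OF W' W W'W])
  have iso: "(W *\<^sub>v x) \<bullet>c (W *\<^sub>v y) = x \<bullet>c y"
    if "x \<in> carrier_vec (Suc n)" "y \<in> carrier_vec (Suc n)" for x y
    using that W W' W'W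
    by (simp add: inner_mat_adjoint[OF W] flip: W'_def assoc_mult_mat_vec[OF W' W])
  define B where "B = W' * (A * W)"
  have B: "B \<in> carrier_mat (Suc n) (Suc n)" using A W W' by (simp add: B_def)
  have "mat_adjoint B = W' * A * W"
    unfolding B_def using A W W'
    by (simp add: mat_adjoint_mult[of _ "Suc n" "Suc n" _ "Suc n"] adjA W'_def
        mat_adjoint_adjoint[OF W])
  hence "mat_adjoint B = B" using A W W' by (simp add: B_def)
  hence hB: "cnj (B $$ (j,i)) = B $$ (i,j)" if "i < Suc n" "j < Suc n" for i j
    using hermitian_mat_iff[OF B] B that by (auto simp: hermitian_mat_def)
  have "W * B = (W * W') * (A * W)"
    unfolding B_def using A W W' by (intro assoc_mult_mat[symmetric]) auto
  hence WB: "W * B = A * W" using A W by (simp add: WW')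
  have AW0: "A *\<^sub>v col W 0 = k \<cdot>\<^sub>v col W 0"
    using A v by (simp add: W0 mult_mat_vec[OF A v(1)] smult_smult_assoc mult.commute)
  have "col B 0 = W' *\<^sub>v (A *\<^sub>v col W 0)"
    unfolding B_def using A W W'
    by (metis col_mult2 mult_carrier_mat zero_less_Suc)
  also have "\<dots> = k \<cdot>\<^sub>v col (W' * W) 0"
    unfolding AW0 col_mult2[OF W' W zero_less_Suc]
    by (rule mult_mat_vec[OF W' col_carrier_vec[OF zero_less_Suc W]])
  finally have colB: "col B 0 = k \<cdot>\<^sub>v unit_vec (Suc n) 0" by (simp add: W'W)
  have B0: "B $$ (i,0) = (if i = 0 then k else 0)" if "i < Suc n" for i
    using arg_cong[OF colB, of "\<lambda>x. x $ i"] that B by (auto simp: unit_vec_def)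
  have B0': "B $$ (0,i) = (if i = 0 then k else 0)" if "i < Suc n" for i
    using hB[of 0 i] hB[of 0 0] B0[OF that] B0[of 0] that by (auto split: if_splits)
  have "cnj k = k" using hB[of 0 0] B0[of 0] by simp
  then obtain e where e: "k = complex_of_real e" by (metis Reals_cnj_iff Reals_cases)
  define C where "C = mat n n (\<lambda>(i,j). B $$ (Suc i, Suc j))"
  have C: "C \<in> carrier_mat n n" by (simp add: C_def)
  have "hermitian_mat C"
    unfolding hermitian_mat_iff[OF C] using hB by (auto simp: C_def)
  from Suc.IH[OF C this] obtain u d where
    u: "\<And>i. i < n \<Longrightarrow> u i \<in> carrier_vec n"
    and ev: "\<And>i. i < n \<Longrightarrow> C *\<^sub>v u i = complex_of_real (d i) \<cdot>\<^sub>v u i"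
    and on: "\<And>i j. i < n \<Longrightarrow> j < n \<Longrightarrow> u i \<bullet>c u j = (if i = j then 1 else 0)"
    by metis
  have lift: "B *\<^sub>v vCons 0 x = vCons 0 (C *\<^sub>v x)" if x: "x \<in> carrier_vec n" for x
  proof (rule eq_vecI)
    fix i assume "i < dim_vec (vCons 0 (C *\<^sub>v x))"
    hence i: "i < Suc n" using C by simp
    have "(B *\<^sub>v vCons 0 x) $ i = (\<Sum>j<n. B $$ (i, Suc j) * x $ j)"
      using i B x by (simp add: scalar_prod_def atLeast0LessThan sum.lessThan_Suc_shift
          del: sum.lessThan_Suc)
    also have "\<dots> = vCons 0 (C *\<^sub>v x) $ i"
      using i C x B0' by (cases i) (auto simp: scalar_prod_def C_def atLeast0LessThan)
    finally show "(B *\<^sub>v vCons 0 x) $ i = vCons 0 (C *\<^sub>v x) $ i" .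
  qed (use B C in auto)
  define x where "x i = (case i of 0 \<Rightarrow> unit_vec (Suc n) 0 | Suc i \<Rightarrow> vCons 0 (u i))" for i
  define f where "f i = (case i of 0 \<Rightarrow> e | Suc i \<Rightarrow> d i)" for i
  have xc: "x i \<in> carrier_vec (Suc n)" if "i < Suc n" for i
    using that u by (cases i) (auto simp: x_def)
  have B0c: "B *\<^sub>v unit_vec (Suc n) 0 = k \<cdot>\<^sub>v unit_vec (Suc n) 0"
    using B B0 by (intro eq_vecI) (auto simp: scalar_prod_right_unit)
  have xB: "B *\<^sub>v x i = complex_of_real (f i) \<cdot>\<^sub>v x i" if "i < Suc n" for i
  proof (cases i)
    case (Suc j)
    hence "B *\<^sub>v x i = vCons 0 (complex_of_real (d j) \<cdot>\<^sub>v u j)"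
      using that u ev by (simp add: x_def lift)
    also have "\<dots> = complex_of_real (f i) \<cdot>\<^sub>v x i"
      using Suc by (intro eq_vecI) (auto simp: x_def f_def vec_index_vCons)
    finally show ?thesis .
  qed (use B0c in \<open>simp add: x_def f_def e\<close>)
  have unit: "unit_vec (Suc n) 0 = vCons 1 (0\<^sub>v n :: complex vec)"
    by (intro eq_vecI) (auto simp: vec_index_vCons)
  have xon: "x i \<bullet>c x j = (if i = j then 1 else 0)" if "i < Suc n" "j < Suc n" for i j
    using that u on by (cases i; cases j) (auto simp: x_def unit)
  have "A *\<^sub>v (W *\<^sub>v x i) = complex_of_real (f i) \<cdot>\<^sub>v (W *\<^sub>v x i)" if "i < Suc n" for i
  proof -
    have "A *\<^sub>v (W *\<^sub>v x i) = W *\<^sub>v (B *\<^sub>v x i)"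
      using A W B xc[OF that] WB by (metis assoc_mult_mat_vec)
    thus ?thesis using xB[OF that] mult_mat_vec[OF W xc[OF that]] by simp
  qed
  thus ?case using xc xon iso W
    by (intro exI[of _ "\<lambda>i. W *\<^sub>v x i"] exI[of _ f]) auto
qed


lemma spectral_decomposition_exists:
  assumes A: "A \<in> carrier_mat n n" and h: "hermitian_mat A"
  shows "\<exists>U d. spectral_decomposition A U d"
proof -
  obtain u d where
    u: "\<And>i. i < n \<Longrightarrow> u i \<in> carrier_vec n"
    and ev: "\<And>i. i < n \<Longrightarrow> A *\<^sub>v u i = complex_of_real (d i) \<cdot>\<^sub>v u i"
    and on: "\<And>i j. i < n \<Longrightarrow> j < n \<Longrightarrow> u i \<bullet>c u j = (if i = j then 1 else 0)"
    using hermitian_eigenbasis[OF A h] by metis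
  define U where "U = mat_of_cols n (map u [0..<n])"
  define D where "D = real_diag n d"
  have U: "U \<in> carrier_mat n n" by (simp add: U_def mat_of_cols_def)
  have U': "mat_adjoint U \<in> carrier_mat n n" using U by simp
  have D: "D \<in> carrier_mat n n" by (simp add: D_def)
  have col: "col U i = u i" if "i < n" for i using that u by (simp add: U_def)
  have U'U: "mat_adjoint U * U = 1\<^sub>m n"
  proof (rule eq_matI)
    fix i j assume "i < dim_row (1\<^sub>m n :: complex mat)" "j < dim_col (1\<^sub>m n :: complex mat)"
    hence ij: "i < n" "j < n" by auto
    show "(mat_adjoint U * U) $$ (i,j) = 1\<^sub>m n $$ (i,j)"
      unfolding mat_adjoint_self_mult_index[OF U ij] using ij by (simp add: col on)
  qed (use U in auto)
  have UU': "U * mat_adjoint U = 1\<^sub>m n" by (rule mat_mult_left_right_inverse[OF U' U U'U])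
  have "A * U = U * D"
  proof (rule eq_matI)
    fix i j assume "i < dim_row (U * D)" "j < dim_col (U * D)"
    hence ij: "i < n" "j < n" using U D by auto
    have "(A * U) $$ (i,j) = (A *\<^sub>v u j) $ i" using A U ij col by simp
    also have "\<dots> = complex_of_real (d j) * U $$ (i,j)"
      using ij u ev[OF ij(2)] U by (simp add: col[symmetric])
    also have "\<dots> = (U * D) $$ (i,j)"
      using ij U by (simp add: D_def real_diag_def mat_diag_mult_right[OF U])
    finally show "(A * U) $$ (i,j) = (U * D) $$ (i,j)" .
  qed (use A U D in auto)
  hence "U * D * mat_adjoint U = A * (U * mat_adjoint U)"
    using A U U' by (metis assoc_mult_mat)
  hence "A = U * D * mat_adjoint U" using A by (simp add: UU')
  hence "spectral_decomposition A U d"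
    using A U U' U'U UU'
    by (auto simp: spectral_decomposition_def unitary_mat_def inverts_mat_def D_def)
  thus ?thesis by blast
qed

section \<open>Positive matrices and the quadratic form\<close>

text \<open>
  Matrices of unspecified size have no additive unit and hence no finite sums as a type; taking the
  sum entrywise at a fixed size avoids this.
\<close>
definition mat_lincomb ::
  "nat \<Rightarrow> ('k \<Rightarrow> real) \<Rightarrow> ('k \<Rightarrow> complex mat) \<Rightarrow> 'k set \<Rightarrow> complex mat" where
  "mat_lincomb n c N K = mat n n (\<lambda>(a,b). \<Sum>k\<in>K. complex_of_real (c k) * N k $$ (a,b))"

definition rank_one_mat :: "nat \<Rightarrow> complex vec \<Rightarrow> complex mat" where
  "rank_one_mat n w = mat n n (\<lambda>(a,b). w $ a * cnj (w $ b))"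

lemma mat_lincomb_carrier [simp]: "mat_lincomb n c N K \<in> carrier_mat n n"
  by (simp add: mat_lincomb_def)

lemma rank_one_mat_carrier [simp]: "rank_one_mat n w \<in> carrier_mat n n"
  by (simp add: rank_one_mat_def)

lemma quadratic_form_eq:
  assumes "A \<in> carrier_mat n n" "v \<in> carrier_vec n"
  shows "(A *\<^sub>v v) \<bullet>c v = (\<Sum>a<n. \<Sum>b<n. A $$ (a,b) * (v $ b * cnj (v $ a)))"
  using assms by (simp add: scalar_prod_def sum_distrib_right atLeast0LessThan mult.assoc)

lemma quadratic_form_mat_lincomb:
  assumes N: "\<And>k. k \<in> K \<Longrightarrow> N k \<in> carrier_mat n n" and v: "v \<in> carrier_vec n"
  shows "(mat_lincomb n c N K *\<^sub>v v) \<bullet>c v =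
    (\<Sum>k\<in>K. complex_of_real (c k) * ((N k *\<^sub>v v) \<bullet>c v))"
proof -
  have "(mat_lincomb n c N K *\<^sub>v v) \<bullet>c v =
    (\<Sum>a<n. \<Sum>b<n. \<Sum>k\<in>K. complex_of_real (c k) * (N k $$ (a,b) * (v $ b * cnj (v $ a))))"
    unfolding quadratic_form_eq[OF mat_lincomb_carrier v]
    by (intro sum.cong refl) (simp add: mat_lincomb_def sum_distrib_right mult.assoc)
  also have "\<dots> = (\<Sum>a<n. \<Sum>k\<in>K. \<Sum>b<n. complex_of_real (c k) * (N k $$ (a,b) * (v $ b * cnj (v $ a))))"
    by (intro sum.cong refl sum.swap)
  also have "\<dots> = (\<Sum>k\<in>K. \<Sum>a<n. \<Sum>b<n. complex_of_real (c k) * (N k $$ (a,b) * (v $ b * cnj (v $ a))))"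
    by (rule sum.swap)
  also have "\<dots> = (\<Sum>k\<in>K. complex_of_real (c k) * ((N k *\<^sub>v v) \<bullet>c v))"
    by (intro sum.cong refl) (simp add: quadratic_form_eq[OF N v] sum_distrib_left)
  finally show ?thesis .
qed

lemma quadratic_form_rank_one_mat:
  assumes v: "v \<in> carrier_vec n" and w: "w \<in> carrier_vec n"
  shows "(rank_one_mat n w *\<^sub>v v) \<bullet>c v = (w \<bullet>c v) * cnj (w \<bullet>c v)"
  using v w unfolding quadratic_form_eq[OF rank_one_mat_carrier v]
  by (simp add: rank_one_mat_def scalar_prod_def sum_product atLeast0LessThan mult_ac) (rule sum.swap)

lemma hermitian_mat_lincomb:
  assumes N: "\<And>k. k \<in> K \<Longrightarrow> N k \<in> carrier_mat n n" "\<And>k. k \<in> K \<Longrightarrow> hermitian_mat (N k)"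
  shows "hermitian_mat (mat_lincomb n c N K)"
proof -
  have "cnj (N k $$ (j,i)) = N k $$ (i,j)" if "k \<in> K" "i < n" "j < n" for k i j
    using hermitian_mat_iff[OF N(1)] N(2) that by blast
  thus ?thesis
    unfolding hermitian_mat_iff[OF mat_lincomb_carrier] by (simp add: mat_lincomb_def)
qed

text \<open>
  The column-times-row expansion of \<open>Z D Z\<^sup>*\<close>. With \<open>Z\<close> unitary it is the spectral
  resolution of a Hermitian matrix; with \<open>Z = X\<^sup>* U\<close> it expands a congruence of one.
\<close>
lemma mat_diag_conjugation_eq_lincomb:
  assumes Z: "Z \<in> carrier_mat n m"
  shows "Z * real_diag m d * mat_adjoint Z =
    mat_lincomb n d (\<lambda>i. rank_one_mat n (col Z i)) {..<m}"
proof (rule eq_matI)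
  fix a b assume "a < dim_row (mat_lincomb n d (\<lambda>i. rank_one_mat n (col Z i)) {..<m})"
    "b < dim_col (mat_lincomb n d (\<lambda>i. rank_one_mat n (col Z i)) {..<m})"
  hence ab: "a < n" "b < n" by (auto simp: mat_lincomb_def)
  show "(Z * real_diag m d * mat_adjoint Z) $$ (a,b) =
    mat_lincomb n d (\<lambda>i. rank_one_mat n (col Z i)) {..<m} $$ (a,b)"
    using ab Z
    by (simp add: real_diag_def mat_diag_mult_right[OF Z] scalar_prod_def mat_lincomb_def
        rank_one_mat_def mat_adjoint_index[OF Z] atLeast0LessThan mult_ac)
qed (use Z in \<open>auto simp: mat_lincomb_def\<close>)

text \<open>
  At an eigenvector \<open>v\<close> with eigenvalue \<open>k\<close> the form takes the value \<open>k (v \<bullet>c v)\<close>, and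
  \<open>v \<bullet>c v > 0\<close>.
\<close>
lemma positive_mat_if_quadratic_form:
  assumes A: "A \<in> carrier_mat n n" and h: "hermitian_mat A"
    and q: "\<And>v. v \<in> carrier_vec n \<Longrightarrow> 0 \<le> (A *\<^sub>v v) \<bullet>c v"
  shows "positive_mat A"
  unfolding positive_mat_def
proof (intro conjI h allI impI)
  fix k assume "eigenvalue A k"
  then obtain v where v: "v \<in> carrier_vec n" "v \<noteq> 0\<^sub>v n" "A *\<^sub>v v = k \<cdot>\<^sub>v v"
    using A unfolding eigenvalue_def eigenvector_def by auto
  have "0 < v \<bullet>c v" using v by simp
  moreover have "0 \<le> k * (v \<bullet>c v)" using q[OF v(1)] v by simp
  ultimately show "0 \<le> k"
    by (auto simp: less_eq_complex_def less_complex_def zero_le_mult_iff)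
qed

lemma positive_mat_spectrum_nonneg:
  assumes A: "A \<in> carrier_mat n n" and pos: "positive_mat A"
    and sd: "spectral_decomposition A U d" and i: "i < n"
  shows "0 \<le> d i"
proof -
  define D where "D = real_diag n d"
  have D: "D \<in> carrier_mat n n" by (simp add: D_def)
  have U: "U \<in> carrier_mat n n" and U': "mat_adjoint U \<in> carrier_mat n n"
    and U'U: "mat_adjoint U * U = 1\<^sub>m n" and eq: "A = U * D * mat_adjoint U"
    using sd A by (auto simp: spectral_decomposition_def unitary_mat_def inverts_mat_def D_def)
  have "A * U = U * D * (mat_adjoint U * U)"
    unfolding eq by (rule assoc_mult_mat) (use U D U' in auto)
  hence AU: "A * U = U * D" using U D by (simp add: U'U)
  have "A *\<^sub>v col U i = col (A * U) i" by (rule col_mult2[OF A U i, symmetric])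
  also have "\<dots> = complex_of_real (d i) \<cdot>\<^sub>v col U i"
    unfolding AU D_def real_diag_def mat_diag_mult_right[OF U]
    using U i by (intro eq_vecI) auto
  finally have ev: "A *\<^sub>v col U i = complex_of_real (d i) \<cdot>\<^sub>v col U i" .
  have "col U i \<bullet>c col U i = 1"
    using mat_adjoint_self_mult_index[OF U i i] U'U i by simp
  hence "col U i \<noteq> 0\<^sub>v n" by auto
  hence "eigenvalue A (complex_of_real (d i))"
    using ev U A i unfolding eigenvalue_def eigenvector_def
    by (intro exI[of _ "col U i"]) auto
  thus ?thesis using pos by (auto simp: positive_mat_def less_eq_complex_def)
qed

text \<open>
  By the spectral resolution of \<open>A\<close>, the form is a sum of terms \<open>d i |col U i \<bullet>c v|\<^sup>2\<close> with
  eigenvalues \<open>d i \<ge> 0\<close>.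
\<close>
lemma quadratic_form_nonneg:
  assumes A: "A \<in> carrier_mat n n" and pos: "positive_mat A" and v: "v \<in> carrier_vec n"
  shows "0 \<le> (A *\<^sub>v v) \<bullet>c v"
proof -
  obtain U d where sd: "spectral_decomposition A U d"
    using spectral_decomposition_exists[OF A] pos by (auto simp: positive_mat_def)
  have U: "U \<in> carrier_mat n n" using sd A by (auto simp: spectral_decomposition_def)
  have "A = U * real_diag n d * mat_adjoint U"
    using sd A by (auto simp: spectral_decomposition_def)
  hence eq: "A = mat_lincomb n d (\<lambda>i. rank_one_mat n (col U i)) {..<n}"
    using mat_diag_conjugation_eq_lincomb[OF U] by metis
  have "(A *\<^sub>v v) \<bullet>c v =
    (\<Sum>i<n. complex_of_real (d i) * ((rank_one_mat n (col U i) *\<^sub>v v) \<bullet>c v))"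
    unfolding eq by (rule quadratic_form_mat_lincomb[OF _ v]) simp
  also have "0 \<le> \<dots>"
  proof (rule sum_nonneg)
    fix i assume "i \<in> {..<n}"
    hence "0 \<le> d i" "col U i \<in> carrier_vec n"
      using positive_mat_spectrum_nonneg[OF A pos sd] U by auto
    thus "0 \<le> complex_of_real (d i) * ((rank_one_mat n (col U i) *\<^sub>v v) \<bullet>c v)"
      by (simp add: quadratic_form_rank_one_mat[OF v] less_eq_complex_def)
  qed
  finally show ?thesis .
qed

text \<open>
  Positive matrices form a convex cone: unlike the spectrum, the quadratic form is linear in the
  matrix.
\<close>
lemma positive_mat_lincomb:
  assumes N: "\<And>k. k \<in> K \<Longrightarrow> N k \<in> carrier_mat n n" "\<And>k. k \<in> K \<Longrightarrow> positive_mat (N k)"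
    and c: "\<And>k. k \<in> K \<Longrightarrow> 0 \<le> c k"
  shows "positive_mat (mat_lincomb n c N K)"
proof (rule positive_mat_if_quadratic_form[OF mat_lincomb_carrier])
  show "hermitian_mat (mat_lincomb n c N K)"
    using N by (intro hermitian_mat_lincomb) (auto simp: positive_mat_def)
next
  fix v :: "complex vec" assume v: "v \<in> carrier_vec n"
  have "0 \<le> complex_of_real (c k) * ((N k *\<^sub>v v) \<bullet>c v)" if "k \<in> K" for k
    using c[OF that] quadratic_form_nonneg[OF N[OF that] v] by (simp add: less_eq_complex_def)
  hence "0 \<le> (\<Sum>k\<in>K. complex_of_real (c k) * ((N k *\<^sub>v v) \<bullet>c v))" by (rule sum_nonneg)
  thus "0 \<le> (mat_lincomb n c N K *\<^sub>v v) \<bullet>c v"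
    by (simp add: quadratic_form_mat_lincomb[OF N(1) v])
qed

lemma positive_rank_one_mat:
  assumes w: "w \<in> carrier_vec n"
  shows "positive_mat (rank_one_mat n w)"
proof (rule positive_mat_if_quadratic_form[OF rank_one_mat_carrier])
  show "hermitian_mat (rank_one_mat n w)"
    unfolding hermitian_mat_iff[OF rank_one_mat_carrier] by (simp add: rank_one_mat_def)
qed (simp add: quadratic_form_rank_one_mat[OF _ w] less_eq_complex_def)

section \<open>Expansion of congruences and of multilinear maps\<close>

text \<open>
  The point is the order of quantifiers: the positive matrices \<open>P i\<close> do not depend on the exponent.
\<close>
lemma congruence_mat_rpow:
  assumes A: "A \<in> carrier_mat q q" and pos: "positive_mat A" and X: "X \<in> carrier_mat q q"
  shows "\<exists>(d :: nat \<Rightarrow> real) P. (\<forall>i<q. 0 \<le> d i \<and> P i \<in> carrier_mat q q \<and> positive_mat (P i)) \<and>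
    (\<forall>s. mat_adjoint X * mat_rpow A s * X = mat_lincomb q (\<lambda>i. d i powr s) P {..<q})"
proof -
  obtain U d where sd: "spectral_decomposition A U d"
    using spectral_decomposition_exists[OF A] pos by (auto simp: positive_mat_def)
  have U: "U \<in> carrier_mat q q" using sd A by (auto simp: spectral_decomposition_def)
  define Z where "Z = mat_adjoint X * U"
  have X': "mat_adjoint X \<in> carrier_mat q q" and U': "mat_adjoint U \<in> carrier_mat q q"
    using X U by auto
  have Z: "Z \<in> carrier_mat q q" using X' U by (simp add: Z_def)
  have Z': "mat_adjoint Z = mat_adjoint U * X"
    unfolding Z_def by (simp add: mat_adjoint_mult[OF X' U] mat_adjoint_adjoint[OF X])
  have "mat_adjoint X * mat_rpow A s * X =
    mat_lincomb q (\<lambda>i. d i powr s) (\<lambda>i. rank_one_mat q (col Z i)) {..<q}" for s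
  proof -
    define D where "D = real_diag q (\<lambda>i. d i powr s)"
    have D: "D \<in> carrier_mat q q" by (simp add: D_def)
    note c = mult_carrier_mat[of _ q q _ q] X X' U U' D
    have "mat_adjoint X * mat_rpow A s * X = mat_adjoint X * (U * D * mat_adjoint U) * X"
      using A by (simp add: mat_rpow_eq[OF sd] D_def)
    also have "\<dots> = Z * D * mat_adjoint Z"
      unfolding Z_def Z'[unfolded Z_def] by (simp add: c assoc_mult_mat[of _ q q _ q _ q])
    also have "\<dots> = mat_lincomb q (\<lambda>i. d i powr s) (\<lambda>i. rank_one_mat q (col Z i)) {..<q}"
      unfolding D_def by (rule mat_diag_conjugation_eq_lincomb[OF Z])
    finally show ?thesis .
  qed
  moreover have "positive_mat (rank_one_mat q (col Z i))" if "i < q" for i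
    using that Z by (intro positive_rank_one_mat) auto
  ultimately show ?thesis
    using positive_mat_spectrum_nonneg[OF A pos sd]
    by (intro exI[of _ d] exI[of _ "\<lambda>i. rank_one_mat q (col Z i)"]) simp
qed

text \<open>
  Stated for a map that is linear on \<open>q \<times> q\<close> matrices only, as \<open>multilinear_map2\<close> says nothing
  about matrices of other sizes.
\<close>
lemma linear_map_mat_lincomb:
  assumes car: "\<And>M. M \<in> carrier_mat q q \<Longrightarrow> L M \<in> carrier_mat p p"
    and add: "\<And>M M'. M \<in> carrier_mat q q \<Longrightarrow> M' \<in> carrier_mat q q \<Longrightarrow> L (M + M') = L M + L M'"
    and smult: "\<And>M c. M \<in> carrier_mat q q \<Longrightarrow> L (c \<cdot>\<^sub>m M) = c \<cdot>\<^sub>m L M"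
    and "finite K" and "\<And>k. k \<in> K \<Longrightarrow> N k \<in> carrier_mat q q"
  shows "L (mat_lincomb q c N K) = mat_lincomb p c (\<lambda>k. L (N k)) K"
  using assms(4,5)
proof (induction K rule: finite_induct)
  case empty
  have "mat_lincomb q c N {} = 0 \<cdot>\<^sub>m 0\<^sub>m q q" by (auto simp: mat_lincomb_def)
  hence "L (mat_lincomb q c N {}) = 0 \<cdot>\<^sub>m L (0\<^sub>m q q)"
    using smult[OF zero_carrier_mat] by metis
  also have "\<dots> = mat_lincomb p c (\<lambda>k. L (N k)) {}"
    using car[OF zero_carrier_mat] by (auto simp: mat_lincomb_def)
  finally show ?case .
next
  case (insert k K)
  have Nk: "N k \<in> carrier_mat q q" using insert.prems by simp
  have split: "mat_lincomb n c M (insert k K) = complex_of_real (c k) \<cdot>\<^sub>m M k + mat_lincomb n c M K"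
    if "M k \<in> carrier_mat n n" for n M
    using that insert.hyps by (auto simp: mat_lincomb_def)
  show ?case
    using insert.IH insert.prems
    by (simp add: split Nk add car smult)
qed

lemma multilinear_map2_mat_lincomb:
  assumes ml: "multilinear_map2 q p \<Phi>" and fin: "finite I" "finite J"
    and P: "\<And>i. i \<in> I \<Longrightarrow> P i \<in> carrier_mat q q" and Q: "\<And>j. j \<in> J \<Longrightarrow> Q j \<in> carrier_mat q q"
  shows "\<Phi> (mat_lincomb q c P I) (mat_lincomb q e Q J) =
    mat_lincomb p (\<lambda>(i,j). c i * e j) (\<lambda>(i,j). \<Phi> (P i) (Q j)) (I \<times> J)"
proof -
  have "\<Phi> (mat_lincomb q c P I) (mat_lincomb q e Q J) =
    mat_lincomb p c (\<lambda>i. \<Phi> (P i) (mat_lincomb q e Q J)) I"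
    using ml fin P
    by (intro linear_map_mat_lincomb[where L = "\<lambda>M. \<Phi> M (mat_lincomb q e Q J)"])
       (auto simp: multilinear_map2_def)
  also have "\<dots> = mat_lincomb p c (\<lambda>i. mat_lincomb p e (\<lambda>j. \<Phi> (P i) (Q j)) J) I"
  proof -
    have "\<Phi> (P i) (mat_lincomb q e Q J) = mat_lincomb p e (\<lambda>j. \<Phi> (P i) (Q j)) J" if "i \<in> I" for i
      using ml fin Q P[OF that]
      by (intro linear_map_mat_lincomb[where L = "\<Phi> (P i)"]) (auto simp: multilinear_map2_def)
    thus ?thesis by (simp add: mat_lincomb_def cong: sum.cong)
  qed
  also have "\<dots> = mat_lincomb p (\<lambda>(i,j). c i * e j) (\<lambda>(i,j). \<Phi> (P i) (Q j)) (I \<times> J)"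
    by (rule eq_matI)
       (auto simp: mat_lincomb_def sum_distrib_left mult.assoc sum.cartesian_product split_def)
  finally show ?thesis .
qed

section \<open>Convexity\<close>

text \<open>
  Both values of \<open>exp\<close> on the right lie above the tangent at the intermediate point \<open>m\<close>, and the
  corresponding combination of tangent values is \<open>exp m\<close>.
\<close>
lemma exp_convex_combination:
  fixes x y \<theta> :: real
  assumes "0 \<le> \<theta>" "\<theta> \<le> 1"
  shows "exp (\<theta> * x + (1 - \<theta>) * y) \<le> \<theta> * exp x + (1 - \<theta>) * exp y"
proof -
  define m where "m = \<theta> * x + (1 - \<theta>) * y"
  have tangent: "exp m * (1 + (z - m)) \<le> exp z" for z
    using mult_left_mono[OF exp_ge_add_one_self[of "z - m"], of "exp m"]
    by (simp add: exp_add[symmetric])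
  have "exp m = \<theta> * (exp m * (1 + (x - m))) + (1 - \<theta>) * (exp m * (1 + (y - m)))"
    unfolding m_def by (simp add: algebra_simps)
  also have "\<dots> \<le> \<theta> * exp x + (1 - \<theta>) * exp y"
    using assms by (intro add_mono mult_left_mono tangent) auto
  finally show ?thesis unfolding m_def .
qed

text \<open>
  For positive \<open>d\<close> and \<open>e\<close> the function \<open>g\<close> is the exponential of an affine function.
\<close>
lemma powr_mult_powr_convex:
  fixes d e s t \<theta> :: real
  assumes "0 \<le> d" "0 \<le> e" "0 \<le> \<theta>" "\<theta> \<le> 1"
  defines "g \<equiv> \<lambda>t. d powr (1 + t) * e powr (1 - t)"
  shows "g (\<theta> * s + (1 - \<theta>) * t) \<le> \<theta> * g s + (1 - \<theta>) * g t"
proof (cases "d = 0 \<or> e = 0")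
  case False
  hence "g r = exp ((1 + r) * ln d + (1 - r) * ln e)" for r
    using assms by (simp add: g_def powr_def exp_add)
  moreover have "(1 + (\<theta> * s + (1 - \<theta>) * t)) * ln d + (1 - (\<theta> * s + (1 - \<theta>) * t)) * ln e
    = \<theta> * ((1 + s) * ln d + (1 - s) * ln e) + (1 - \<theta>) * ((1 + t) * ln d + (1 - t) * ln e)"
    by (simp add: algebra_simps)
  ultimately show ?thesis using exp_convex_combination[OF assms(3,4)] by simp
next
  \<comment> \<open>Here \<open>0 powr r = 0\<close> for every \<open>r\<close>, so \<open>g\<close> vanishes.\<close>
  case True
  thus ?thesis by (auto simp: g_def)
qed

text \<open>
  The defect \<open>\<theta> f s + (1 - \<theta>) f t - f (\<theta> s + (1 - \<theta>) t)\<close> is again a combination of the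
  \<open>N k\<close>, with the nonnegative convexity defects of the \<open>g _ k\<close> as coefficients.
\<close>
lemma mat_lincomb_convex:
  assumes f: "\<And>t. f t = mat_lincomb p (g t) N K"
    and N: "\<And>k. k \<in> K \<Longrightarrow> N k \<in> carrier_mat p p" "\<And>k. k \<in> K \<Longrightarrow> positive_mat (N k)"
    and g: "\<And>k s t \<theta>. k \<in> K \<Longrightarrow> 0 \<le> \<theta> \<Longrightarrow> \<theta> \<le> 1 \<Longrightarrow>
      g (\<theta> * s + (1 - \<theta>) * t) k \<le> \<theta> * g s k + (1 - \<theta>) * g t k"
  shows "loewner_convex f"
  unfolding loewner_convex_def loewner_le_def
proof (intro allI impI)
  fix s t \<theta> :: real assume \<theta>: "0 \<le> \<theta>" "\<theta> \<le> 1"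
  have "complex_of_real \<theta> \<cdot>\<^sub>m f s + complex_of_real (1 - \<theta>) \<cdot>\<^sub>m f t - f (\<theta> * s + (1 - \<theta>) * t) =
    mat_lincomb p (\<lambda>k. \<theta> * g s k + (1 - \<theta>) * g t k - g (\<theta> * s + (1 - \<theta>) * t) k) N K"
    unfolding f by (rule eq_matI)
      (auto simp: mat_lincomb_def sum_distrib_left sum.distrib sum_subtractf algebra_simps)
  moreover have "positive_mat \<dots>"
    using N g[OF _ \<theta>] by (intro positive_mat_lincomb) auto
  ultimately show "positive_mat (complex_of_real \<theta> \<cdot>\<^sub>m f s + complex_of_real (1 - \<theta>) \<cdot>\<^sub>m f t -
    f (\<theta> * s + (1 - \<theta>) * t))" by simp
qed

text \<open>
  The point \<open>0\<close> is the midpoint of \<open>t\<close> and \<open>- t\<close>.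
\<close>
lemma loewner_convex_even_minimum:
  assumes "loewner_convex f" and even: "f (- t) = f t" and f: "f t \<in> carrier_mat p p"
  shows "loewner_le (f 0) (f t)"
proof -
  have conv: "loewner_le (f (\<theta> * r + (1 - \<theta>) * s))
      (complex_of_real \<theta> \<cdot>\<^sub>m f r + complex_of_real (1 - \<theta>) \<cdot>\<^sub>m f s)"
    if "0 \<le> \<theta>" "\<theta> \<le> 1" for r s \<theta>
    using assms(1) that unfolding loewner_convex_def by blast
  have "loewner_le (f (1/2 * t + (1 - 1/2) * (- t)))
    (complex_of_real (1/2) \<cdot>\<^sub>m f t + complex_of_real (1 - 1/2) \<cdot>\<^sub>m f (- t))"
    by (rule conv) auto
  moreover have "complex_of_real (1/2) \<cdot>\<^sub>m f t + complex_of_real (1 - 1/2) \<cdot>\<^sub>m f (- t) = f t"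
    unfolding even using f by (intro eq_matI) auto
  ultimately show ?thesis by simp
qed

theorem theorem4p2:
  fixes p q :: nat
    and \<Phi> :: "complex mat \<Rightarrow> complex mat \<Rightarrow> complex mat"
    and A B X Y :: "complex mat"
    and f :: "real \<Rightarrow> complex mat"
  assumes "multilinear_map2 q p \<Phi>" and "positive_map2 q \<Phi>"
    and "A \<in> carrier_mat q q" and "B \<in> carrier_mat q q"
    and "X \<in> carrier_mat q q" and "Y \<in> carrier_mat q q"
    and "strictly_positive_mat A" and "strictly_positive_mat B"
    and f: "\<And>t. f t =
       \<Phi> (mat_adjoint X * mat_rpow A (1 + t) * X) (mat_adjoint Y * mat_rpow B (1 - t) * Y) +
       \<Phi> (mat_adjoint X * mat_rpow A (1 - t) * X) (mat_adjoint Y * mat_rpow B (1 + t) * Y)"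
  shows "(\<forall>t. hermitian_mat (f t)) \<and> loewner_convex f \<and> (\<forall>t. loewner_le (f 0) (f t))"
proof -
  obtain d :: "nat \<Rightarrow> real" and P where d: "\<And>i. i < q \<Longrightarrow> 0 \<le> d i"
    and P: "\<And>i. i < q \<Longrightarrow> P i \<in> carrier_mat q q" "\<And>i. i < q \<Longrightarrow> positive_mat (P i)"
    and XA: "\<And>s. mat_adjoint X * mat_rpow A s * X = mat_lincomb q (\<lambda>i. d i powr s) P {..<q}"
    using congruence_mat_rpow[of A q X] assms by (auto simp: strictly_positive_mat_def)
  obtain e :: "nat \<Rightarrow> real" and Q where e: "\<And>j. j < q \<Longrightarrow> 0 \<le> e j"
    and Q: "\<And>j. j < q \<Longrightarrow> Q j \<in> carrier_mat q q" "\<And>j. j < q \<Longrightarrow> positive_mat (Q j)"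
    and YB: "\<And>s. mat_adjoint Y * mat_rpow B s * Y = mat_lincomb q (\<lambda>j. e j powr s) Q {..<q}"
    using congruence_mat_rpow[of B q Y] assms by (auto simp: strictly_positive_mat_def)
  define K where "K = {..<q} \<times> {..<q}"
  define N where "N = (\<lambda>(i,j). \<Phi> (P i) (Q j))"
  define g where "g t = (\<lambda>(i,j). d i powr (1 + t) * e j powr (1 - t) +
    d i powr (1 - t) * e j powr (1 + t))" for t
  have N: "N k \<in> carrier_mat p p" "positive_mat (N k)" if "k \<in> K" for k
    using that assms(1,2) P Q
    by (auto simp: N_def K_def multilinear_map2_def positive_map2_def)
  have fK: "f t = mat_lincomb p (g t) N K" for t
  proof -
    have \<Phi>: "\<Phi> (mat_lincomb q c P {..<q}) (mat_lincomb q c' Q {..<q}) =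
      mat_lincomb p (\<lambda>(i,j). c i * c' j) N K" for c c'
      unfolding N_def K_def
      using P Q by (intro multilinear_map2_mat_lincomb[OF assms(1)]) auto
    show ?thesis
      unfolding f XA YB \<Phi>
      by (rule eq_matI) (auto simp: mat_lincomb_def g_def split_def distrib_right sum.distrib)
  qed
  have "g (\<theta> * s + (1 - \<theta>) * t) k \<le> \<theta> * g s k + (1 - \<theta>) * g t k"
    if "k \<in> K" "0 \<le> \<theta>" "\<theta> \<le> 1" for k s t \<theta>
  proof -
    obtain i j where k: "k = (i,j)" "0 \<le> d i" "0 \<le> e j"
      using \<open>k \<in> K\<close> d e by (auto simp: K_def)
    show ?thesis
      \<comment> \<open>The second summand is the first one with the roles of \<open>d i\<close> and \<open>e j\<close> exchanged.\<close>
      using powr_mult_powr_convex[OF k(2,3) that(2,3), of s t]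
        powr_mult_powr_convex[OF k(3,2) that(2,3), of s t]
      by (simp add: g_def k(1) distrib_left mult.commute[of "e j powr _" "d i powr _"])
  qed
  hence conv: "loewner_convex f" using mat_lincomb_convex[of f p g, OF fK N] by blast
  have even: "f (- t) = f t" for t
    unfolding fK g_def by (simp add: add.commute)
  have "hermitian_mat (f t)" for t
    unfolding fK using N by (intro hermitian_mat_lincomb) (auto simp: positive_mat_def)
  moreover have "loewner_le (f 0) (f t)" for t
    using loewner_convex_even_minimum[OF conv even, of t p] by (simp add: fK)
  ultimately show ?thesis using conv by blast
qed

end
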